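(* For all positive integers $k,n$ and every integer $r\geq 1$, $$\sigma^{(k)}_{r,o}\mathrm{mex}(n)=\sum_{m\geq 0}\Big[\epsilon_m(m+1)^k-(1-\epsilon_m)m^k\Big]\,p\big(n-t_r(m)\big)$$ and $$\sigma^{(k)}_{r,e}\mathrm{mex}(n)=\sum_{m\geq 0}\Big[(1-\epsilon_m)(m+1)^k-\epsilon_m m^k\Big]\,p\big(n-t_r(m)\big),$$ where $\epsilon_m=\frac{1+(-1)^m}{2}$.
   Context: For an integer $n\ge 0$, $p(n)$ denotes the number of partitions of $n$, with $p(0)=1$ and $p(n)=0$ for $n<0$; $\mathcal{P}(n)$ is the set of all partitions of $n$. For an integer $r\geq 1$ and a partition $\pi$, $r\text{-}\mathrm{mex}(\pi)$ (the least $r$-gap) is the least positive integer that does not occur at least $r$ times as a part of $\pi$. Define $$\sigma^{(k)}_{r,o}\mathrm{mex}(n):=\sum_{\substack{\pi\in\mathcal{P}(n)\\ 2\nmid r\text{-}\mathrm{mex}(\pi)}}\big(r\text{-}\mathrm{mex}(\pi)\big)^k,\qquad \sigma^{(k)}_{r,e}\mathrm{mex}(n):=\sum_{\substack{\pi\in\mathcal{P}(n)\\ 2\mid r\text{-}\mathrm{mex}(\pi)}}\big(r\text{-}\mathrm{mex}(\pi)\big)^k.$$ For $m\geq 0$, $t_r(m):=r\cdot\frac{m(m+1)}{2}$. All sums are finite (only finitely many nonzero terms). *)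

theory Defs
  imports Complex_Main "HOL-Library.Multiset"
begin

text \<open>A partition of \<open>n\<close> is the finite multiset of its (positive) parts.\<close>

definition partitions :: "nat \<Rightarrow> nat multiset set" where
  "partitions n = {\<pi>. 0 \<notin># \<pi> \<and> \<Sum>\<^sub># \<pi> = n}"

lemma finite_partitions [simp]: "finite (partitions n)"
proof -
  have "\<pi> \<in> (\<Union>i\<le>n. multisets_of_size {..n} i)" if "\<pi> \<in> partitions n" for \<pi>
  proof -
    from that have pos: "0 \<notin># \<pi>" and sum: "\<Sum>\<^sub># \<pi> = n"
      by (auto simp: partitions_def)
    from pos have "size \<pi> \<le> \<Sum>\<^sub># \<pi>"
      by (induction \<pi>) auto
    moreover have "x \<le> n" if "x \<in># \<pi>" for x
      using that sum by (metis le_add1 multi_member_split sum_mset.add_mset)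
    ultimately show ?thesis
      using sum by (auto simp: multisets_of_size_def)
  qed
  then have "partitions n \<subseteq> (\<Union>i\<le>n. multisets_of_size {..n} i)" by blast
  then show ?thesis
    by (rule finite_subset) auto
qed

text \<open>The partition function is taken on the integers, so that \<open>n - t\<^sub>r(m)\<close> is a
  genuine (non-truncated) difference.\<close>

definition partition_number :: "int \<Rightarrow> nat" where
  "partition_number z = (if z < 0 then 0 else card (partitions (nat z)))"

text \<open>For \<open>r = 0\<close> no such \<open>j\<close> exists; \<open>r_mex\<close> is only meaningful for \<open>r \<ge> 1\<close>.\<close>

definition r_mex :: "nat \<Rightarrow> nat multiset \<Rightarrow> nat" where
  "r_mex r \<pi> = (LEAST j. 0 < j \<and> \<not> r \<le> count \<pi> j)"

lemma r_mex_exists: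
  fixes \<pi> :: "nat multiset"
  assumes "r \<ge> 1"
  shows "\<exists>j>0. \<not> r \<le> count \<pi> j"
proof -
  obtain j where "j \<notin> insert 0 (set_mset \<pi>)"
    using ex_new_if_finite[OF infinite_UNIV_nat, of "insert 0 (set_mset \<pi>)"] by auto
  then show ?thesis
    using assms by (intro exI[of _ j]) (auto simp: not_in_iff)
qed

definition sigma_r_o_mex :: "nat \<Rightarrow> nat \<Rightarrow> nat \<Rightarrow> nat" where
  "sigma_r_o_mex k r n = (\<Sum>\<pi> \<in> {\<pi> \<in> partitions n. \<not> 2 dvd r_mex r \<pi>}. r_mex r \<pi> ^ k)"

definition sigma_r_e_mex :: "nat \<Rightarrow> nat \<Rightarrow> nat \<Rightarrow> nat" where
  "sigma_r_e_mex k r n = (\<Sum>\<pi> \<in> {\<pi> \<in> partitions n. 2 dvd r_mex r \<pi>}. r_mex r \<pi> ^ k)"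

definition t_num :: "nat \<Rightarrow> nat \<Rightarrow> nat" where
  "t_num r m = r * (m * (m + 1) div 2)"

definition eps :: "nat \<Rightarrow> real" where
  "eps m = (1 + (-1) ^ m) / 2"

text \<open>Series in \<open>m\<close> whose terms carry the factor \<open>p(n - t\<^sub>r(m))\<close> have only
  finitely many nonzero terms, so \<open>suminf\<close> is a finite sum for them.\<close>

lemma finite_partition_number_support:
  assumes "r \<ge> 1"
  shows "finite {m. partition_number (int n - int (t_num r m)) \<noteq> 0}"
proof (rule finite_subset)
  show "{m. partition_number (int n - int (t_num r m)) \<noteq> 0} \<subseteq> {..n}"
  proof
    fix m
    assume nz: "m \<in> {m. partition_number (int n - int (t_num r m)) \<noteq> 0}"
    show "m \<in> {..n}"
    proof (rule ccontr)
      assume "m \<notin> {..n}"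
      then have m: "n < m" by simp
      then have "m * 2 \<le> m * (m + 1)" by (intro mult_le_mono2) linarith
      then have "m \<le> m * (m + 1) div 2" by linarith
      also have "\<dots> \<le> t_num r m"
        unfolding t_num_def using assms by simp
      finally show False
        using m nz by (simp add: partition_number_def)
    qed
  qed
qed simp

end

theory Submission
  imports Defs
begin

text \<open>The \<open>r\<close>-mex of \<open>\<pi>\<close> exceeds \<open>m\<close> iff \<open>\<pi>\<close> contains \<open>r\<close> copies of each of \<open>1, \<dots>, m\<close>;
  removing these copies is a bijection onto the partitions of \<open>n - t\<^sub>r(m)\<close>.  Hence, by telescoping,
  the sum of \<open>f (r-mex \<pi>)\<close> over the partitions \<open>\<pi>\<close> of \<open>n\<close> equals
  \<open>\<Sum>m. (f (m + 1) - f m) * p (n - t\<^sub>r(m))\<close> whenever \<open>f 0 = 0\<close>.  The two identities are the cases in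
  which \<open>f j\<close> is \<open>j ^ k\<close> cut off to odd, respectively even, \<open>j\<close>.\<close>

definition staircase :: "nat \<Rightarrow> nat \<Rightarrow> nat multiset" where
  "staircase r m = (\<Sum>i\<in>{1..m}. replicate_mset r i)"

lemma count_staircase: "count (staircase r m) j = (if 1 \<le> j \<and> j \<le> m then r else 0)"
  by (auto simp: staircase_def count_sum)

lemma sum_mset_staircase: "\<Sum>\<^sub># (staircase r m) = t_num r m"
proof -
  have "\<Sum>\<^sub># (staircase r m) = r * (\<Sum>i\<in>{1..m}. i)"
    unfolding staircase_def by (induction m) (auto simp: algebra_simps)
  also have "(\<Sum>i\<in>{1..m}. i) = m * (m + 1) div 2"
    using gauss_sum_from_Suc_0[of m, where 'a = nat] by simp
  finally show ?thesis by (simp add: t_num_def)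
qed

lemma zero_notin_staircase: "0 \<notin># staircase r m"
  by (simp add: not_in_iff count_staircase)

lemma less_r_mex_iff:
  assumes "r \<ge> 1"
  shows "m < r_mex r \<pi> \<longleftrightarrow> staircase r m \<subseteq># \<pi>"
proof -
  have "0 < r_mex r \<pi> \<and> \<not> r \<le> count \<pi> (r_mex r \<pi>)"
    unfolding r_mex_def using r_mex_exists[OF assms, of \<pi>] by (rule LeastI_ex)
  moreover have "r \<le> count \<pi> j" if "0 < j" "j < r_mex r \<pi>" for j
    using not_less_Least[of j "\<lambda>j. 0 < j \<and> \<not> r \<le> count \<pi> j"] that by (auto simp: r_mex_def)
  \<comment> \<open>If \<open>r_mex r \<pi> \<le> m\<close>, then \<open>j = r_mex r \<pi>\<close>
    itself violates the right-hand side; the converse direction is minimality.\<close>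
  ultimately have "m < r_mex r \<pi> \<longleftrightarrow> (\<forall>j. 1 \<le> j \<and> j \<le> m \<longrightarrow> r \<le> count \<pi> j)"
    by (metis One_nat_def Suc_le_eq le_less_trans linorder_not_less)
  then show ?thesis
    by (auto simp: subseteq_mset_def count_staircase)
qed

lemma card_partitions_r_mex_gt:
  assumes "r \<ge> 1"
  shows "card {\<pi> \<in> partitions n. m < r_mex r \<pi>} = partition_number (int n - int (t_num r m))"
proof (cases "t_num r m \<le> n")
  case True
  \<comment> \<open>The map is injective by cancellation. It keeps all parts positive because the
    staircase has no part 0.\<close>
  have "{\<pi> \<in> partitions n. m < r_mex r \<pi>} = (+) (staircase r m) ` partitions (n - t_num r m)"
    using True zero_notin_staircase[of r m]
    by (fastforce simp: less_r_mex_iff[OF assms] partitions_def sum_mset_staircase image_iff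
        mset_subset_eq_exists_conv)
  then show ?thesis
    using True by (simp add: card_image partition_number_def nat_diff_distrib)
next
  case False
  then have "{\<pi> \<in> partitions n. m < r_mex r \<pi>} = {}"
    by (auto simp: less_r_mex_iff[OF assms] partitions_def sum_mset_staircase
        mset_subset_eq_exists_conv)
  then show ?thesis
    using False by (simp add: partition_number_def)
qed

lemma sum_r_mex_telescope:
  fixes f :: "nat \<Rightarrow> real"
  assumes r: "r \<ge> 1" and f0: "f 0 = 0"
  shows "(\<Sum>\<pi>\<in>partitions n. f (r_mex r \<pi>)) =
    (\<Sum>m. (f (Suc m) - f m) * real (partition_number (int n - int (t_num r m))))"
proof -
  \<comment> \<open>One finite index set that serves every \<open>\<pi>\<close>: it permits
    exchanging the two sums and turns the series into a finite sum.\<close>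
  define S where "S = {m. partition_number (int n - int (t_num r m)) \<noteq> 0}"
  have S: "finite S"
    unfolding S_def by (rule finite_partition_number_support[OF r])
  have f_eq: "f (r_mex r \<pi>) = (\<Sum>m\<in>S. if m < r_mex r \<pi> then f (Suc m) - f m else 0)"
    if "\<pi> \<in> partitions n" for \<pi>
  proof -
    \<comment> \<open>For \<open>m < r_mex r \<pi>\<close>, the partition \<open>\<pi>\<close>
      itself is among those counted by \<open>p(n - t_r(m))\<close>, so this number is
      nonzero.\<close>
    have "{..<r_mex r \<pi>} \<subseteq> S"
      using that by (auto simp: S_def card_partitions_r_mex_gt[OF r, symmetric])
    then have "{m \<in> S. m < r_mex r \<pi>} = {..<r_mex r \<pi>}" by auto
    then show ?thesis
      using S f0 by (simp add: sum.inter_filter[symmetric] sum_lessThan_telescope)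
  qed
  have "(\<Sum>\<pi>\<in>partitions n. f (r_mex r \<pi>)) =
      (\<Sum>\<pi>\<in>partitions n. \<Sum>m\<in>S. if m < r_mex r \<pi> then f (Suc m) - f m else 0)"
    by (intro sum.cong refl f_eq)
  \<comment> \<open>After the exchange, the difference at \<open>m\<close> is taken once for each
    partition with \<open>r\<close>-mex above \<open>m\<close>.\<close>
  also have "\<dots> = (\<Sum>m\<in>S. (f (Suc m) - f m) * real (partition_number (int n - int (t_num r m))))"
    by (subst sum.swap) (simp add: sum.inter_filter[symmetric] card_partitions_r_mex_gt[OF r] mult.commute)
  also have "\<dots> = (\<Sum>m. (f (Suc m) - f m) * real (partition_number (int n - int (t_num r m))))"
    using S by (intro suminf_finite[symmetric]) (auto simp: S_def)
  finally show ?thesis .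
qed

lemma eps_eq: "eps m = (if even m then 1 else 0)"
  by (simp add: eps_def)

theorem theorem1p5:
  fixes k n r :: nat
  assumes "k \<ge> 1" and "n \<ge> 1" and "r \<ge> 1"
  shows "real (sigma_r_o_mex k r n) =
      (\<Sum>m. (eps m * (real m + 1) ^ k - (1 - eps m) * real m ^ k)
             * real (partition_number (int n - int (t_num r m))))
    \<and> real (sigma_r_e_mex k r n) =
      (\<Sum>m. ((1 - eps m) * (real m + 1) ^ k - eps m * real m ^ k)
             * real (partition_number (int n - int (t_num r m))))"
proof
  define f where "f = (\<lambda>j. if odd j then real j ^ k else 0)"
  define g where "g = (\<lambda>j. if even j then real j ^ k else 0)"
  have "real (sigma_r_o_mex k r n) = (\<Sum>\<pi>\<in>partitions n. f (r_mex r \<pi>))"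
    by (simp add: sigma_r_o_mex_def f_def sum.inter_filter[symmetric])
  also have "\<dots> = (\<Sum>m. (f (Suc m) - f m) * real (partition_number (int n - int (t_num r m))))"
    using assms(3) by (rule sum_r_mex_telescope) (simp add: f_def)
  \<comment> \<open>Exactly one of \<open>m\<close> and \<open>Suc m\<close> is odd, so just one of
    the two terms survives; \<open>eps m\<close> selects it.\<close>
  also have "(\<lambda>m. f (Suc m) - f m) = (\<lambda>m. eps m * (real m + 1) ^ k - (1 - eps m) * real m ^ k)"
    by (auto simp: f_def eps_eq add.commute)
  finally show "real (sigma_r_o_mex k r n) =
      (\<Sum>m. (eps m * (real m + 1) ^ k - (1 - eps m) * real m ^ k)
             * real (partition_number (int n - int (t_num r m))))" .
  have "real (sigma_r_e_mex k r n) = (\<Sum>\<pi>\<in>partitions n. g (r_mex r \<pi>))"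
    by (simp add: sigma_r_e_mex_def g_def sum.inter_filter[symmetric])
  also have "\<dots> = (\<Sum>m. (g (Suc m) - g m) * real (partition_number (int n - int (t_num r m))))"
    \<comment> \<open>Since 0 is even, \<open>g 0\<close> is \<open>0 ^ k\<close>, which vanishes
      because \<open>k \<ge> 1\<close>.\<close>
    using assms(3) by (rule sum_r_mex_telescope) (use assms(1) in \<open>simp add: g_def\<close>)
  also have "(\<lambda>m. g (Suc m) - g m) = (\<lambda>m. (1 - eps m) * (real m + 1) ^ k - eps m * real m ^ k)"
    by (auto simp: g_def eps_eq add.commute)
  finally show "real (sigma_r_e_mex k r n) =
      (\<Sum>m. ((1 - eps m) * (real m + 1) ^ k - eps m * real m ^ k)
             * real (partition_number (int n - int (t_num r m))))" .
qed

end
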